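(* Let $f:\mathbb{R}^d\to\mathbb{R}$ be differentiable and $L$-smooth ($\|\nabla f(x)-\nabla f(y)\|\le L\|x-y\|$ for all $x,y$), with $\Delta=f(x^0)-\inf_x f(x)$, (optionally $f$ is also $\rho$-weakly convex for some $\rho\ge 0$), and let the stochastic gradients satisfy $\mathbb{E}_\xi[\nabla f(x;\xi)]=\nabla f(x)$ and $\mathbb{E}_\xi[\|\nabla f(x;\xi)-\nabla f(x)\|^2]\le\sigma^2$ for all $x$. Using the analysis of Koloskova et al. (2020) or (under $\rho$-weak convexity) of Luo et al. (2025), the time complexity of canonical Local SGD to find an $\varepsilon$-stationary point is not better than $$\sqrt{\tau h\,\frac{L^2\sigma^2\Delta^2}{\varepsilon^3}}+h\left(\frac{L\Delta}{\varepsilon}+\frac{L\sigma^2\Delta}{n\varepsilon^2}\right)$$ up to constant factors. Precisely: let $\Psi(K,R)$ be either of the two convergence guarantees $$\Psi_1(K,R)=\frac{L\Delta}{R}+\sqrt{\frac{L\sigma^2\Delta}{nKR}}+\frac{(L\sigma\Delta)^{2/3}}{K^{1/3}R^{2/3}},\qquad \Psi_2(K,R)=\left(\frac{L}{K}+\rho\right)\frac{\Delta}{R}+\sqrt{\frac{L\sigma^2\Delta}{nKR}}+\frac{(L\sigma\Delta)^{2/3}}{K^{1/3}R^{2/3}},$$ and let $C_0>0$ be a universal constant. Then there is a constant $c>0$ depending only on $C_0$ such that for all $n\in\mathbb N$, $L,\Delta,\varepsilon,h,\tau>0$, $\sigma,\rho\ge 0$, and all integers $K,R\ge1$ for which the guarantee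 certifies $\varepsilon$-stationarity, i.e. $C_0\Psi(K,R)\le\varepsilon$, one has $$\tau R+hKR\;\ge\;c\left[\sqrt{\tau h\,\frac{L^2\sigma^2\Delta^2}{\varepsilon^3}}+h\left(\frac{L\Delta}{\varepsilon}+\frac{L\sigma^2\Delta}{n\varepsilon^2}\right)\right].$$
   Context: Canonical Local SGD with $n$ workers, starting point $x^0$, local step size $\eta_\ell$, $R$ rounds, $K$ local steps: for $t=0,\dots,R-1$, each worker $i$ in parallel sets $z^t_{i,0}=x^t$ and performs $z^t_{i,j+1}=z^t_{i,j}-\eta_\ell\nabla f(z^t_{i,j};\xi^t_{i,j})$, $j=0,\dots,K-1$, $\xi^t_{i,j}\sim\mathcal D$ independent; then $x^{t+1}=\frac1n\sum_{i=1}^nz^t_{i,K}$. An $\varepsilon$-stationary point is a (possibly random) $\bar x$ with $\mathbb{E}[\|\nabla f(\bar x)\|^2]\le\varepsilon$. The cited analyses guarantee (for the best step size) that after $R$ rounds with $K$ local steps Local SGD finds $\bar x$ with $\mathbb{E}[\|\nabla f(\bar x)\|^2]\le C_0\Psi_1(K,R)$ (Koloskova et al.), respectively $\le C_0\Psi_2(K,R)$ under $\rho$-weak convexity (Luo et al.), with a universal constant $C_0$. Time model: one stochastic gradient takes at most $h$ seconds on each worker, workers compute in parallel, one communication takes at most $\tau$ seconds; so $R$ rounds with $K$ local steps are charged $\tau R+hKR$ seconds. *)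

theory Defs
  imports "HOL-Analysis.Analysis" "HOL-Probability.Probability"
begin

definition smooth_with_gradient ::
    "real \<Rightarrow> (real ^ 'd \<Rightarrow> real) \<Rightarrow> (real ^ 'd \<Rightarrow> real ^ 'd) \<Rightarrow> bool" where
  "smooth_with_gradient L f gf \<longleftrightarrow>
     (\<forall>x. GDERIV f x :> gf x) \<and> (\<forall>x y. norm (gf x - gf y) \<le> L * norm (x - y))"

definition weakly_convex :: "real \<Rightarrow> (real ^ 'd \<Rightarrow> real) \<Rightarrow> bool" where
  "weakly_convex \<rho> f \<longleftrightarrow> convex_on UNIV (\<lambda>x. f x + \<rho> / 2 * (norm x)\<^sup>2)"

(* The integrability clauses are needed because the Bochner integral of a
   non-integrable function is 0. *)
definition stochastic_gradient ::
    "'s measure \<Rightarrow> (real ^ 'd \<Rightarrow> 's \<Rightarrow> real ^ 'd) \<Rightarrow> (real ^ 'd \<Rightarrow> real ^ 'd) \<Rightarrow> real \<Rightarrow> bool" where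
  "stochastic_gradient D G gf \<sigma> \<longleftrightarrow>
     prob_space D \<and>
     (\<forall>x. integrable D (G x) \<and> (LINT \<xi>|D. G x \<xi>) = gf x) \<and>
     (\<forall>x. integrable D (\<lambda>\<xi>. (norm (G x \<xi> - gf x))\<^sup>2) \<and>
          (LINT \<xi>|D. (norm (G x \<xi> - gf x))\<^sup>2) \<le> \<sigma>\<^sup>2)"

(* Convergence guarantees for Local SGD with n workers, K local steps and R rounds:
   Psi1 is due to Koloskova et al. (2020), Psi2 to Luo et al. (2025). *)

definition Psi1 :: "nat \<Rightarrow> real \<Rightarrow> real \<Rightarrow> real \<Rightarrow> nat \<Rightarrow> nat \<Rightarrow> real" where
  "Psi1 n L \<Delta> \<sigma> K R =
     L * \<Delta> / real R
     + sqrt (L * \<sigma>\<^sup>2 * \<Delta> / (real n * real K * real R))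
     + (L * \<sigma> * \<Delta>) powr (2/3) / (real K powr (1/3) * real R powr (2/3))"

definition Psi2 :: "nat \<Rightarrow> real \<Rightarrow> real \<Rightarrow> real \<Rightarrow> real \<Rightarrow> nat \<Rightarrow> nat \<Rightarrow> real" where
  "Psi2 n L \<Delta> \<sigma> \<rho> K R =
     (L / real K + \<rho>) * (\<Delta> / real R)
     + sqrt (L * \<sigma>\<^sup>2 * \<Delta> / (real n * real K * real R))
     + (L * \<sigma> * \<Delta>) powr (2/3) / (real K powr (1/3) * real R powr (2/3))"

(* One communication (\<tau> seconds) per round; the K local steps (h seconds each) of a round
   are sequential on every worker, while the workers run in parallel. *)
definition local_sgd_time :: "real \<Rightarrow> real \<Rightarrow> nat \<Rightarrow> nat \<Rightarrow> real" where
  "local_sgd_time \<tau> h K R = \<tau> * real R + h * real K * real R"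

(* The time complexity of Local SGD established by an analysis whose guarantee on the expected
   squared gradient norm after R rounds with K local steps is B K R: the least time charged to
   a choice of K and R for which B certifies an \<epsilon>-stationary point. *)
definition certified_time_complexity ::
    "real \<Rightarrow> real \<Rightarrow> real \<Rightarrow> (nat \<Rightarrow> nat \<Rightarrow> real) \<Rightarrow> ereal" where
  "certified_time_complexity \<tau> h \<epsilon> B =
     (INF (K, R) \<in> {(K, R). 1 \<le> K \<and> 1 \<le> R \<and> B K R \<le> \<epsilon>}. ereal (local_sgd_time \<tau> h K R))"

definition time_lower_bound ::
    "nat \<Rightarrow> real \<Rightarrow> real \<Rightarrow> real \<Rightarrow> real \<Rightarrow> real \<Rightarrow> real \<Rightarrow> real" where
  "time_lower_bound n L \<Delta> \<sigma> \<epsilon> \<tau> h =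
     sqrt (\<tau> * h * (L\<^sup>2 * \<sigma>\<^sup>2 * \<Delta>\<^sup>2 / \<epsilon> ^ 3))
     + h * (L * \<Delta> / \<epsilon> + L * \<sigma>\<^sup>2 * \<Delta> / (real n * \<epsilon>\<^sup>2))"

end

theory Submission
  imports Defs
begin

text \<open>Both guarantees are sums of three nonnegative terms, so a certificate
  \<open>C \<Psi>(K, R) \<le> \<epsilon>\<close> bounds each term by \<open>\<epsilon> / C\<close>. The optimization term is at least
  \<open>L \<Delta> / (K R)\<close> in either guarantee, because local steps speed it up by at most a factor \<open>K\<close>;
  hence the total number \<open>K R\<close> of sequential gradient steps is at least of order
  \<open>L \<Delta> / \<epsilon>\<close>. The statistical term, squared, forces \<open>K R\<close> to be at least of order
  \<open>L \<sigma>\<^sup>2 \<Delta> / (n \<epsilon>\<^sup>2)\<close>. The client-drift term, cubed, forces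
  \<open>K R\<^sup>2\<close> to be at least of order \<open>L\<^sup>2 \<sigma>\<^sup>2 \<Delta>\<^sup>2 / \<epsilon>\<^sup>3\<close>; here \<open>R\<close> counts twice, so the bound
  does not concern computation or communication alone. What links it to time is the inequality of
  arithmetic and geometric means: \<open>\<tau> R + h K R \<ge> 2 sqrt (\<tau> h K R\<^sup>2)\<close> for every
  choice of \<open>K\<close> and \<open>R\<close>, which removes the trade-off between the two.

  The constants lost are \<open>C\<close>, \<open>C\<^sup>2\<close> and \<open>2 sqrt (C\<^sup>3)\<close>. The least of them, divided by three
  because the time is compared with a sum of three lower bounds, can be taken as the constant
  of the theorem. Passing to the
  infimum over all certified \<open>(K, R)\<close> gives the statement about time complexities.\<close>

lemma certified_terms:
  fixes A B D C \<epsilon> :: real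
  assumes "C > 0" "A \<ge> 0" "B \<ge> 0" "D \<ge> 0" "C * (A + B + D) \<le> \<epsilon>"
  shows "C * A \<le> \<epsilon>" "C * B \<le> \<epsilon>" "C * D \<le> \<epsilon>"
proof -
  have "C * A \<ge> 0" "C * B \<ge> 0" "C * D \<ge> 0"
    using assms by simp_all
  then show "C * A \<le> \<epsilon>" "C * B \<le> \<epsilon>" "C * D \<le> \<epsilon>"
    using assms(5) by (simp_all add: distrib_left)
qed

lemma optimization_term_Psi1_ge:
  fixes L \<Delta> :: real
  assumes "L > 0" "\<Delta> \<ge> 0" "K \<ge> 1" "R \<ge> 1"
  shows "L * \<Delta> / (real K * real R) \<le> L * \<Delta> / real R"
proof (rule divide_left_mono)
  show "real R \<le> real K * real R"
    using assms mult_right_mono[of 1 "real K" "real R"] by simp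
qed (use assms in auto)

lemma optimization_term_Psi2_ge:
  fixes L \<Delta> \<rho> :: real
  assumes "\<Delta> \<ge> 0" "\<rho> \<ge> 0"
  shows "L * \<Delta> / (real K * real R) \<le> (L / real K + \<rho>) * (\<Delta> / real R)"
proof -
  have "(L / real K) * (\<Delta> / real R) \<le> (L / real K + \<rho>) * (\<Delta> / real R)"
    using assms by (intro mult_right_mono) auto
  then show ?thesis by simp
qed

lemma statistical_term_certificate:
  fixes L \<Delta> \<sigma> \<epsilon> C :: real
  assumes "L > 0" "\<Delta> \<ge> 0" "\<epsilon> > 0" "C > 0" "n \<ge> 1" "K \<ge> 1" "R \<ge> 1"
    and cert: "C * sqrt (L * \<sigma>\<^sup>2 * \<Delta> / (real n * real K * real R)) \<le> \<epsilon>"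
  shows "C\<^sup>2 * (L * \<sigma>\<^sup>2 * \<Delta> / (real n * \<epsilon>\<^sup>2)) \<le> real K * real R"
proof -
  have "(C * sqrt (L * \<sigma>\<^sup>2 * \<Delta> / (real n * real K * real R)))\<^sup>2 \<le> \<epsilon>\<^sup>2"
    using assms by (intro power_mono cert) auto
  moreover have "(C * sqrt (L * \<sigma>\<^sup>2 * \<Delta> / (real n * real K * real R)))\<^sup>2
      = C\<^sup>2 * (L * \<sigma>\<^sup>2 * \<Delta> / (real n * real K * real R))"
    using assms by (simp add: power_mult_distrib)
  ultimately have "C\<^sup>2 * (L * \<sigma>\<^sup>2 * \<Delta> / (real n * real K * real R)) \<le> \<epsilon>\<^sup>2"
    by simp
  then show ?thesis
    using assms by (simp add: field_simps)
qed

text \<open>The exponents are thirds, so cubing turns the drift term into a rational expression.\<close>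

lemma drift_term_certificate:
  fixes L \<Delta> \<sigma> \<epsilon> C :: real
  assumes "L > 0" "\<Delta> \<ge> 0" "\<sigma> \<ge> 0" "\<epsilon> > 0" "C > 0" "K \<ge> 1" "R \<ge> 1"
    and cert: "C * ((L * \<sigma> * \<Delta>) powr (2/3) / (real K powr (1/3) * real R powr (2/3))) \<le> \<epsilon>"
  shows "C ^ 3 * (L\<^sup>2 * \<sigma>\<^sup>2 * \<Delta>\<^sup>2 / \<epsilon> ^ 3) \<le> real K * (real R)\<^sup>2"
proof -
  \<comment> \<open>For \<open>\<sigma> = 0\<close> or \<open>\<Delta> = 0\<close> the base is \<open>0\<close>, where \<open>0 powr a = 0\<close> keeps the rule valid.\<close>
  have cube_powr: "(x powr (2/3)) ^ 3 = x\<^sup>2" "(x powr (1/3)) ^ 3 = x" if "x \<ge> 0" for x :: real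
    using that by (cases "x = 0"; simp add: powr_power)+
  have "(C * ((L * \<sigma> * \<Delta>) powr (2/3) / (real K powr (1/3) * real R powr (2/3)))) ^ 3 \<le> \<epsilon> ^ 3"
    using assms by (intro power_mono cert) auto
  moreover have "(C * ((L * \<sigma> * \<Delta>) powr (2/3) / (real K powr (1/3) * real R powr (2/3)))) ^ 3
      = C ^ 3 * (L * \<sigma> * \<Delta>)\<^sup>2 / (real K * (real R)\<^sup>2)"
    using assms by (simp add: power_mult_distrib power_divide cube_powr)
  ultimately have "C ^ 3 * (L * \<sigma> * \<Delta>)\<^sup>2 / (real K * (real R)\<^sup>2) \<le> \<epsilon> ^ 3"
    by simp
  then show ?thesis
    using assms by (simp add: field_simps)
qed

lemma local_sgd_time_ge_geometric_mean:
  assumes "\<tau> \<ge> 0" "h \<ge> 0"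
  shows "2 * sqrt (\<tau> * h * (real K * (real R)\<^sup>2)) \<le> local_sgd_time \<tau> h K R"
proof -
  have "sqrt ((\<tau> * real R) * (h * real K * real R)) \<le> (\<tau> * real R + h * real K * real R) / 2"
    using assms by (intro arith_geo_mean_sqrt) auto
  moreover have "(\<tau> * real R) * (h * real K * real R) = \<tau> * h * (real K * (real R)\<^sup>2)"
    by (simp add: power2_eq_square)
  ultimately show ?thesis
    by (simp add: local_sgd_time_def)
qed

text \<open>The factor \<open>2\<close> comes from the inequality of means and the \<open>3\<close> from the number of
  summands in the time bound.\<close>

definition rate_constant :: "real \<Rightarrow> real" where
  "rate_constant C = min C (min (C\<^sup>2) (2 * sqrt (C ^ 3))) / 3"

lemma rate_constant_pos: "C > 0 \<Longrightarrow> rate_constant C > 0"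
  by (simp add: rate_constant_def)

text \<open>The two guarantees differ only in their optimization term, which is kept abstract as \<open>A\<close>:
  the argument needs only that it improves at most linearly with the number of local steps. The case \<open>\<Delta> = 0\<close> is included so that the lemma applies when
  the starting point is already a minimizer.\<close>

lemma certified_time_ge:
  fixes A L \<Delta> \<sigma> \<epsilon> \<tau> h C :: real
  assumes pos: "L > 0" "\<Delta> \<ge> 0" "\<sigma> \<ge> 0" "\<epsilon> > 0" "h > 0" "\<tau> > 0" "C > 0"
    and one: "n \<ge> 1" "K \<ge> 1" "R \<ge> 1"
    and A: "L * \<Delta> / (real K * real R) \<le> A"
    and cert: "C * (A + sqrt (L * \<sigma>\<^sup>2 * \<Delta> / (real n * real K * real R))
       + (L * \<sigma> * \<Delta>) powr (2/3) / (real K powr (1/3) * real R powr (2/3))) \<le> \<epsilon>"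
  shows "rate_constant C * time_lower_bound n L \<Delta> \<sigma> \<epsilon> \<tau> h \<le> local_sgd_time \<tau> h K R"
proof -
  let ?T = "local_sgd_time \<tau> h K R" and ?m = "3 * rate_constant C"
  let ?X = "sqrt (\<tau> * h * (L\<^sup>2 * \<sigma>\<^sup>2 * \<Delta>\<^sup>2 / \<epsilon> ^ 3))"
  let ?Y = "h * (L * \<Delta> / \<epsilon>)" and ?Z = "h * (L * \<sigma>\<^sup>2 * \<Delta> / (real n * \<epsilon>\<^sup>2))"
  have m: "?m \<le> C" "?m \<le> C\<^sup>2" "?m \<le> 2 * sqrt (C ^ 3)"
    by (auto simp: rate_constant_def)
  have "A \<ge> 0"
    using A pos by (meson divide_nonneg_nonneg mult_nonneg_nonneg of_nat_0_le_iff less_imp_le order_trans)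
  note terms = certified_terms[OF \<open>C > 0\<close> this _ _ cert]
  have optimization: "C * A \<le> \<epsilon>"
    and statistical: "C * sqrt (L * \<sigma>\<^sup>2 * \<Delta> / (real n * real K * real R)) \<le> \<epsilon>"
    and drift: "C * ((L * \<sigma> * \<Delta>) powr (2/3) / (real K powr (1/3) * real R powr (2/3))) \<le> \<epsilon>"
    by (rule terms; use pos in simp)+
  have T: "h * (real K * real R) \<le> ?T"
    using pos by (simp add: local_sgd_time_def)

  have "?m * ?X \<le> 2 * sqrt (C ^ 3) * ?X"
    using pos by (intro mult_right_mono m) auto
  also have "\<dots> = 2 * sqrt (\<tau> * h * (C ^ 3 * (L\<^sup>2 * \<sigma>\<^sup>2 * \<Delta>\<^sup>2 / \<epsilon> ^ 3)))"
    by (simp add: real_sqrt_mult[symmetric] mult_ac)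
  also have "\<dots> \<le> 2 * sqrt (\<tau> * h * (real K * (real R)\<^sup>2))"
    using pos by (intro mult_left_mono real_sqrt_le_mono drift_term_certificate[OF _ _ _ _ _ _ _ drift] one) auto
  also have "\<dots> \<le> ?T"
    using pos by (intro local_sgd_time_ge_geometric_mean) auto
  finally have X: "?m * ?X \<le> ?T" .

  have "C * (L * \<Delta> / (real K * real R)) \<le> \<epsilon>"
    using mult_left_mono[OF A, of C] pos optimization by simp
  then have "C * (L * \<Delta> / \<epsilon>) \<le> real K * real R"
    using pos one by (simp add: field_simps)
  then have "h * (C * (L * \<Delta> / \<epsilon>)) \<le> ?T"
    using T pos by (meson mult_left_mono less_imp_le order_trans)
  moreover have "?m * ?Y \<le> C * ?Y"
    using pos by (intro mult_right_mono m) auto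
  ultimately have Y: "?m * ?Y \<le> ?T"
    by (simp add: mult_ac)

  have "C\<^sup>2 * (L * \<sigma>\<^sup>2 * \<Delta> / (real n * \<epsilon>\<^sup>2)) \<le> real K * real R"
    by (rule statistical_term_certificate[OF _ _ _ _ _ _ _ statistical]) (use pos one in auto)
  then have "h * (C\<^sup>2 * (L * \<sigma>\<^sup>2 * \<Delta> / (real n * \<epsilon>\<^sup>2))) \<le> ?T"
    using T pos by (meson mult_left_mono less_imp_le order_trans)
  moreover have "?m * ?Z \<le> C\<^sup>2 * ?Z"
    using pos by (intro mult_right_mono m) auto
  ultimately have Z: "?m * ?Z \<le> ?T"
    by (simp add: mult_ac)

  have "time_lower_bound n L \<Delta> \<sigma> \<epsilon> \<tau> h = ?X + ?Y + ?Z"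
    by (simp add: time_lower_bound_def distrib_left)
  then show ?thesis
    using X Y Z by (simp add: distrib_left)
qed

lemma Psi1_certified_time_ge:
  fixes L \<Delta> \<sigma> \<epsilon> \<tau> h C :: real
  assumes "L > 0" "\<Delta> \<ge> 0" "\<sigma> \<ge> 0" "\<epsilon> > 0" "h > 0" "\<tau> > 0" "C > 0"
    and "n \<ge> 1" "K \<ge> 1" "R \<ge> 1" and "C * Psi1 n L \<Delta> \<sigma> K R \<le> \<epsilon>"
  shows "rate_constant C * time_lower_bound n L \<Delta> \<sigma> \<epsilon> \<tau> h \<le> local_sgd_time \<tau> h K R"
  by (rule certified_time_ge[OF assms(1-10) optimization_term_Psi1_ge[OF assms(1,2,9,10)]])
    (use assms(11) in \<open>simp only: Psi1_def\<close>)

lemma Psi2_certified_time_ge: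
  fixes L \<Delta> \<sigma> \<rho> \<epsilon> \<tau> h C :: real
  assumes "L > 0" "\<Delta> \<ge> 0" "\<sigma> \<ge> 0" "\<rho> \<ge> 0" "\<epsilon> > 0" "h > 0" "\<tau> > 0" "C > 0"
    and "n \<ge> 1" "K \<ge> 1" "R \<ge> 1" and "C * Psi2 n L \<Delta> \<sigma> \<rho> K R \<le> \<epsilon>"
  shows "rate_constant C * time_lower_bound n L \<Delta> \<sigma> \<epsilon> \<tau> h \<le> local_sgd_time \<tau> h K R"
  by (rule certified_time_ge[OF assms(1-3,5-11) optimization_term_Psi2_ge[OF assms(2,4)]])
    (use assms(12) in \<open>simp only: Psi2_def\<close>)

lemma certified_time_complexity_ge:
  assumes "\<And>K R. K \<ge> 1 \<Longrightarrow> R \<ge> 1 \<Longrightarrow> B K R \<le> \<epsilon> \<Longrightarrow> b \<le> local_sgd_time \<tau> h K R"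
  shows "ereal b \<le> certified_time_complexity \<tau> h \<epsilon> B"
  unfolding certified_time_complexity_def by (rule INF_greatest) (use assms in auto)

theorem theorem2p3:
  fixes C\<^sub>0 :: real
  assumes "C\<^sub>0 > 0"
  shows "\<exists>c>0.
    (\<forall>(n::nat) (L::real) (\<Delta>::real) (\<epsilon>::real) (h::real) (\<tau>::real) (\<sigma>::real) (\<rho>::real).
       n \<ge> 1 \<and> L > 0 \<and> \<Delta> > 0 \<and> \<epsilon> > 0 \<and> h > 0 \<and> \<tau> > 0 \<and> \<sigma> \<ge> 0 \<and> \<rho> \<ge> 0 \<longrightarrow>
       (\<forall>\<Psi> \<in> {Psi1 n L \<Delta> \<sigma>, Psi2 n L \<Delta> \<sigma> \<rho>}. \<forall>(K::nat) (R::nat).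
          K \<ge> 1 \<and> R \<ge> 1 \<and> C\<^sub>0 * \<Psi> K R \<le> \<epsilon> \<longrightarrow>
          local_sgd_time \<tau> h K R \<ge> c * time_lower_bound n L \<Delta> \<sigma> \<epsilon> \<tau> h))
    \<and>
    (\<forall>(f :: real ^ 'd \<Rightarrow> real) (gf :: real ^ 'd \<Rightarrow> real ^ 'd) (x0 :: real ^ 'd)
       (D :: 's measure) (G :: real ^ 'd \<Rightarrow> 's \<Rightarrow> real ^ 'd)
       (n::nat) (L::real) (\<Delta>::real) (\<epsilon>::real) (h::real) (\<tau>::real) (\<sigma>::real).
       smooth_with_gradient L f gf \<and> bdd_below (range f) \<and> \<Delta> = f x0 - (INF x. f x) \<and>
       stochastic_gradient D G gf \<sigma> \<and>
       n \<ge> 1 \<and> L > 0 \<and> \<epsilon> > 0 \<and> h > 0 \<and> \<tau> > 0 \<and> \<sigma> \<ge> 0 \<longrightarrow>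
       certified_time_complexity \<tau> h \<epsilon> (\<lambda>K R. C\<^sub>0 * Psi1 n L \<Delta> \<sigma> K R)
         \<ge> ereal (c * time_lower_bound n L \<Delta> \<sigma> \<epsilon> \<tau> h) \<and>
       (\<forall>\<rho>\<ge>0. weakly_convex \<rho> f \<longrightarrow>
          certified_time_complexity \<tau> h \<epsilon> (\<lambda>K R. C\<^sub>0 * Psi2 n L \<Delta> \<sigma> \<rho> K R)
            \<ge> ereal (c * time_lower_bound n L \<Delta> \<sigma> \<epsilon> \<tau> h)))"
proof (intro exI[of _ "rate_constant C\<^sub>0"] conjI allI impI ballI)
  show "rate_constant C\<^sub>0 > 0"
    by (rule rate_constant_pos) fact
next
  fix n :: nat and L \<Delta> \<epsilon> h \<tau> \<sigma> \<rho> :: real and \<Psi> and K R :: nat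
  assume H: "n \<ge> 1 \<and> L > 0 \<and> \<Delta> > 0 \<and> \<epsilon> > 0 \<and> h > 0 \<and> \<tau> > 0 \<and> \<sigma> \<ge> 0 \<and> \<rho> \<ge> 0"
    and KR: "K \<ge> 1 \<and> R \<ge> 1 \<and> C\<^sub>0 * \<Psi> K R \<le> \<epsilon>"
  assume "\<Psi> \<in> {Psi1 n L \<Delta> \<sigma>, Psi2 n L \<Delta> \<sigma> \<rho>}"
  then consider "\<Psi> = Psi1 n L \<Delta> \<sigma>" | "\<Psi> = Psi2 n L \<Delta> \<sigma> \<rho>"
    by blast
  then show "local_sgd_time \<tau> h K R \<ge> rate_constant C\<^sub>0 * time_lower_bound n L \<Delta> \<sigma> \<epsilon> \<tau> h"
  proof cases
    case 1
    show ?thesis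
      by (rule Psi1_certified_time_ge) (use 1 H KR assms in simp_all)
  next
    case 2
    show ?thesis
      by (rule Psi2_certified_time_ge[where \<rho> = \<rho>]) (use 2 H KR assms in simp_all)
  qed
next
  fix f :: "real ^ 'd \<Rightarrow> real" and gf :: "real ^ 'd \<Rightarrow> real ^ 'd" and x0 :: "real ^ 'd"
    and D :: "'s measure" and G :: "real ^ 'd \<Rightarrow> 's \<Rightarrow> real ^ 'd"
    and n :: nat and L \<Delta> \<epsilon> h \<tau> \<sigma> :: real
  assume H: "smooth_with_gradient L f gf \<and> bdd_below (range f) \<and> \<Delta> = f x0 - (INF x. f x) \<and>
    stochastic_gradient D G gf \<sigma> \<and> n \<ge> 1 \<and> L > 0 \<and> \<epsilon> > 0 \<and> h > 0 \<and> \<tau> > 0 \<and> \<sigma> \<ge> 0"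
  then have "\<Delta> \<ge> 0"
    by (simp add: cINF_lower)
  then show "certified_time_complexity \<tau> h \<epsilon> (\<lambda>K R. C\<^sub>0 * Psi1 n L \<Delta> \<sigma> K R)
      \<ge> ereal (rate_constant C\<^sub>0 * time_lower_bound n L \<Delta> \<sigma> \<epsilon> \<tau> h)"
    using H assms by (intro certified_time_complexity_ge Psi1_certified_time_ge) auto
  fix \<rho> :: real
  assume "\<rho> \<ge> 0"
  then show "certified_time_complexity \<tau> h \<epsilon> (\<lambda>K R. C\<^sub>0 * Psi2 n L \<Delta> \<sigma> \<rho> K R)
      \<ge> ereal (rate_constant C\<^sub>0 * time_lower_bound n L \<Delta> \<sigma> \<epsilon> \<tau> h)"
    using H assms \<open>\<Delta> \<ge> 0\<close>
    by (intro certified_time_complexity_ge Psi2_certified_time_ge[where \<rho> = \<rho>]) auto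
qed

end
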